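(* Let $\tau_1,\tau_2,\kappa,\mu>0$. Assume that $p,e,s$ are smooth functions of $(v,\theta,q,S)$, $v,\theta>0$, obeying the Gibbs equation and the structural assumptions listed in the context. Then $$p=\tilde p(v,\theta)-\frac{\tau_1}{2\kappa\theta}q^2-\frac{\tau_2}{2\mu}S^2,\qquad e=\tilde e(v,\theta)+\frac{\tau_1v}{\kappa\theta}q^2+\frac{\tau_2v}{2\mu}S^2,\qquad s=\tilde s(v,\theta)+\frac{\tau_1v}{2\kappa\theta^2}q^2.$$ Moreover, the relative entropy $$\eta=\left(e+\tfrac12u^2\right)+p^0(v-1)-(s-s^0)-e^0=\tilde\eta(v,u,\theta)+\left(1-\frac1{2\theta}\right)\frac{\tau_1v}{\kappa\theta}q^2+\frac{\tau_2v}{2\mu}S^2$$ satisfies, along solutions of the hyperbolic Navier-Stokes equations, $$\eta_t+\left(u(p-\tilde p(1,1))+\left(1-\frac1\theta\right)q-uS\right)_x+\frac{vq^2}{\kappa\theta^2}+\frac{vS^2}{\mu\theta}=0.$$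
   Context: The hyperbolic Navier-Stokes equations are $$v_t-u_x=0,\ u_t+p_x=S_x,\ (e+\tfrac12u^2)_t+(up)_x+q_x=(uS)_x,\ \tau_1q_t+q+\tfrac{\kappa\theta_x}{v}=0,\ \tau_2S_t+S=\tfrac{\mu u_x}{v},$$ with $v,\theta>0$. Assumptions on $p,e,s$: (i) Gibbs equation $\theta\,\mathrm ds=\mathrm de+p\,\mathrm dv$ at fixed $(q,S)$. In the variables $(v,\theta)$ this gives $\frac{\partial s}{\partial\theta}=\frac1\theta\frac{\partial e}{\partial\theta}$, $\frac{\partial s}{\partial v}=\frac{\partial p}{\partial\theta}$, $\frac{\partial e}{\partial v}=\theta\frac{\partial p}{\partial\theta}-p$. Writing $s=\bar s(v,e,q,S)$ in the variables $(v,e,q,S)$, it gives $\frac{\partial\bar s}{\partial v}=\frac p\theta$, $\frac{\partial\bar s}{\partial e}=\frac1\theta$. (ii) Dissipativity condition: $\frac{\partial\bar s(v,e,q,S)}{\partial q}=-\frac{\tau_1vq}{\kappa\theta^2}$ and $\frac{\partial\bar s(v,e,q,S)}{\partial S}=-\frac{\tau_2vS}{\mu\theta}$. (iii) Quadratic dependence on $(q,S)$: there are functions $a,b,\alpha,\beta$ of $(v,\theta)$ with $e=\tilde e(v,\theta)+a(v,\theta)q^2+b(v,\theta)S^2$ and $p=\tilde p(v,\theta)+\alpha(v,\theta)q^2+\beta(v,\theta)S^2$. Here $\tilde p,\tilde e,\tilde s$ are the pressure, internal energy and entropy for the Navier-Stokes equations with $\tau_1=\tau_2=0$, i.e. the parts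 of $p,e,s$ independent of $(q,S)$. The superscript $0$ denotes values at the equilibrium state: $p^0=p(1,1,0,0)$, $e^0=e(1,1,0,0)$, $s^0=s(1,1,0,0)$. Finally $\tilde\eta(v,u,\theta)=(\tilde e(v,\theta)+\frac12u^2)+p^0(v-1)-(\tilde s(v,\theta)-s^0)-e^0$ is the relative entropy when $\tau_1=\tau_2=0$. *)

theory Defs
  imports "HOL-Analysis.Analysis"
begin

text \<open>Smoothness of a map on an open set: all iterated directional derivatives exist (in the
  Frechet sense) and are continuous.\<close>

primrec times_differentiable_on ::
  "nat \<Rightarrow> ('a::real_normed_vector \<Rightarrow> 'b::real_normed_vector) \<Rightarrow> 'a set \<Rightarrow> bool"
where
  "times_differentiable_on 0 f A \<longleftrightarrow> continuous_on A f"
| "times_differentiable_on (Suc n) f A \<longleftrightarrow>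
     (\<forall>x\<in>A. f differentiable (at x)) \<and>
     (\<forall>w. times_differentiable_on n (\<lambda>x. frechet_derivative f (at x) w) A)"

definition smooth_on :: "('a::real_normed_vector \<Rightarrow> 'b::real_normed_vector) \<Rightarrow> 'a set \<Rightarrow> bool"
  where "smooth_on f A \<longleftrightarrow> (\<forall>n. times_differentiable_on n f A)"

text \<open>A function of the state \<open>(v, \<theta>, q, S)\<close>, or of the energy variables \<open>(v, e, q, S)\<close>.\<close>

type_synonym state_function = "real \<Rightarrow> real \<Rightarrow> real \<Rightarrow> real \<Rightarrow> real"

definition full_state_space :: "(real \<times> real \<times> real \<times> real) set"
  where "full_state_space = {(v, \<theta>, q, S). v > 0 \<and> \<theta> > 0}"

text \<open>The set \<open>D\<close> of states on which the constitutive functions are considered. The whole of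
  \<open>full_state_space\<close> qualifies. Smaller \<open>D\<close> are admitted because \<open>(v, e, q, S)\<close> must be usable as
  variables on \<open>D\<close>: already for an energy of the form
  \<open>C \<theta> + \<tau>1 v q\<^sup>2 / (\<kappa> \<theta>) + \<tau>2 v S\<^sup>2 / (2 \<mu>)\<close> with \<open>C > 0\<close>, the derivative of \<open>e\<close> in \<open>\<theta>\<close>
  changes sign for large \<open>q\<close>. The last condition relates every state to the state
  \<open>(v, \<theta>, 0, 0)\<close> that defines the parts of \<open>p, e, s\<close> independent of \<open>(q, S)\<close>.\<close>

definition state_domain :: "(real \<times> real \<times> real \<times> real) set \<Rightarrow> bool"
  where "state_domain D \<longleftrightarrow>
    open D \<and> D \<subseteq> full_state_space \<and> (1, 1, 0, 0) \<in> D \<and>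
    (\<forall>(v, \<theta>, q, S)\<in>D. \<forall>r\<in>{0..1}. (v, \<theta>, r * q, r * S) \<in> D)"

text \<open>\<open>sbar\<close> is the entropy in the variables \<open>(v, e, q, S)\<close>; its values off the image of \<open>D\<close>
  are irrelevant.\<close>

definition entropy_in_energy_variables ::
  "(real \<times> real \<times> real \<times> real) set \<Rightarrow> state_function \<Rightarrow> state_function \<Rightarrow> state_function \<Rightarrow> bool"
  where "entropy_in_energy_variables D e s sbar \<longleftrightarrow>
    (\<forall>(v, \<theta>, q, S)\<in>D.
       s v \<theta> q S = sbar v (e v \<theta> q S) q S \<and>
       (\<lambda>(v', e', q', S'). sbar v' e' q' S') differentiable (at (v, e v \<theta> q S, q, S)))"

text \<open>The Gibbs equation \<open>\<theta> ds = de + p dv\<close> at fixed \<open>(q, S)\<close>, i.e. the total differential of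
  \<open>sbar\<close> in \<open>(v, e)\<close> is \<open>(de + p dv) / \<theta>\<close>. Its form in the variables \<open>(v, \<theta>)\<close> follows by the
  chain rule.\<close>

definition gibbs_equation ::
  "(real \<times> real \<times> real \<times> real) set \<Rightarrow> state_function \<Rightarrow> state_function \<Rightarrow> state_function \<Rightarrow> bool"
  where "gibbs_equation D p e sbar \<longleftrightarrow>
    (\<forall>(v, \<theta>, q, S)\<in>D.
       ((\<lambda>(v', e'). sbar v' e' q S) has_derivative
          (\<lambda>(dv, de). (de + p v \<theta> q S * dv) / \<theta>)) (at (v, e v \<theta> q S)))"

definition dissipativity ::
  "real \<Rightarrow> real \<Rightarrow> real \<Rightarrow> real \<Rightarrow> (real \<times> real \<times> real \<times> real) set \<Rightarrow>
     state_function \<Rightarrow> state_function \<Rightarrow> bool"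
  where "dissipativity \<tau>1 \<tau>2 \<kappa> \<mu> D e sbar \<longleftrightarrow>
    (\<forall>(v, \<theta>, q, S)\<in>D.
       ((\<lambda>q'. sbar v (e v \<theta> q S) q' S) has_real_derivative - (\<tau>1 * v * q / (\<kappa> * \<theta>\<^sup>2))) (at q) \<and>
       ((\<lambda>S'. sbar v (e v \<theta> q S) q S') has_real_derivative - (\<tau>2 * v * S / (\<mu> * \<theta>))) (at S))"

text \<open>The part of \<open>p, e, s\<close> independent of \<open>(q, S)\<close> (the quantities with a tilde).\<close>

definition ns_part :: "state_function \<Rightarrow> real \<Rightarrow> real \<Rightarrow> real"
  where "ns_part f v \<theta> = f v \<theta> 0 0"

definition quadratic_in_flux :: "(real \<times> real \<times> real \<times> real) set \<Rightarrow> state_function \<Rightarrow> bool"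
  where "quadratic_in_flux D f \<longleftrightarrow>
    (\<exists>a b :: real \<Rightarrow> real \<Rightarrow> real. \<forall>(v, \<theta>, q, S)\<in>D.
       f v \<theta> q S = ns_part f v \<theta> + a v \<theta> * q\<^sup>2 + b v \<theta> * S\<^sup>2)"

definition relative_entropy ::
  "state_function \<Rightarrow> state_function \<Rightarrow> state_function \<Rightarrow>
     real \<Rightarrow> real \<Rightarrow> real \<Rightarrow> real \<Rightarrow> real \<Rightarrow> real"
  where "relative_entropy p e s v u \<theta> q S =
    (e v \<theta> q S + u\<^sup>2 / 2) + p 1 1 0 0 * (v - 1) - (s v \<theta> q S - s 1 1 0 0) - e 1 1 0 0"

definition ns_relative_entropy ::
  "state_function \<Rightarrow> state_function \<Rightarrow> state_function \<Rightarrow> real \<Rightarrow> real \<Rightarrow> real \<Rightarrow> real"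
  where "ns_relative_entropy p e s v u \<theta> =
    (ns_part e v \<theta> + u\<^sup>2 / 2) + p 1 1 0 0 * (v - 1) - (ns_part s v \<theta> - s 1 1 0 0) - e 1 1 0 0"

text \<open>Fields depend on \<open>t\<close> and \<open>x\<close>, in this order.\<close>

type_synonym field = "real \<Rightarrow> real \<Rightarrow> real"

definition dt :: "field \<Rightarrow> field"
  where "dt f t x = deriv (\<lambda>t'. f t' x) t"

definition dx :: "field \<Rightarrow> field"
  where "dx f t x = deriv (\<lambda>x'. f t x') x"

definition along :: "state_function \<Rightarrow> field \<Rightarrow> field \<Rightarrow> field \<Rightarrow> field \<Rightarrow> field"
  where "along f v \<theta> q S = (\<lambda>t x. f (v t x) (\<theta> t x) (q t x) (S t x))"

text \<open>Classical solutions on an open set \<open>W\<close> of space-time, with values in \<open>D\<close>.\<close>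

definition hyperbolic_ns_solution ::
  "real \<Rightarrow> real \<Rightarrow> real \<Rightarrow> real \<Rightarrow> (real \<times> real \<times> real \<times> real) set \<Rightarrow>
     state_function \<Rightarrow> state_function \<Rightarrow>
     (real \<times> real) set \<Rightarrow> field \<Rightarrow> field \<Rightarrow> field \<Rightarrow> field \<Rightarrow> field \<Rightarrow> bool"
  where "hyperbolic_ns_solution \<tau>1 \<tau>2 \<kappa> \<mu> D p e W v u \<theta> q S \<longleftrightarrow>
    open W \<and>
    (\<forall>f\<in>{v, u, \<theta>, q, S}. (\<lambda>(t, x). f t x) differentiable_on W) \<and>
    (\<forall>(t, x)\<in>W.
       (v t x, \<theta> t x, q t x, S t x) \<in> D \<and>
       dt v t x - dx u t x = 0 \<and>
       dt u t x + dx (along p v \<theta> q S) t x = dx S t x \<and>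
       dt (\<lambda>t x. along e v \<theta> q S t x + (u t x)\<^sup>2 / 2) t x
         + dx (\<lambda>t x. u t x * along p v \<theta> q S t x) t x + dx q t x
         = dx (\<lambda>t x. u t x * S t x) t x \<and>
       \<tau>1 * dt q t x + q t x + \<kappa> * dx \<theta> t x / v t x = 0 \<and>
       \<tau>2 * dt S t x + S t x = \<mu> * dx u t x / v t x)"

end

theory Submission
  imports Defs
begin

text \<open>The constitutive laws come from the Massieu function \<open>\<phi> = s - e / \<theta>\<close>. The Gibbs equation
  and the dissipativity condition together give the total differential of the entropy in the
  energy variables, and substituting \<open>e = e(v, \<theta>, q, S)\<close> gives (\<open>massieu_has_derivative\<close>)
  \<open>d\<phi> = e / \<theta>\<^sup>2 d\<theta> + p / \<theta> dv - \<tau>1 v q / (\<kappa> \<theta>\<^sup>2) dq - \<tau>2 v S / (\<mu> \<theta>) dS\<close>.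
  Its \<open>q\<close> and \<open>S\<close> components are explicit functions of the state, so integrating them from
  \<open>(v, \<theta>, 0, 0)\<close> determines how \<open>\<phi>\<close> depends on the fluxes (\<open>massieu_flux_part\<close>).
  Differentiating the result in \<open>\<theta>\<close> recovers \<open>e\<close>, differentiating it in \<open>v\<close> recovers \<open>p\<close>, and
  \<open>s = \<phi> + e / \<theta>\<close>. Integrating in \<open>(q, S)\<close> and then differentiating in
  \<open>(v, \<theta>)\<close> takes the place of equating mixed second derivatives of \<open>s\<close>.

  For the balance law, the differential of the entropy is evaluated along a solution. The momentum
  equation removes the kinetic part of the energy equation, leaving \<open>e\<^sub>t = - p u\<^sub>x - q\<^sub>x + S u\<^sub>x\<close>. The
  two relaxation equations then turn the \<open>q\<^sub>t\<close> and \<open>S\<^sub>t\<close> terms of \<open>s\<^sub>t\<close> into the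
  Clausius--Duhem form \<open>s\<^sub>t + (q / \<theta>)\<^sub>x = v q\<^sup>2 / (\<kappa> \<theta>\<^sup>2) + v S\<^sup>2 / (\<mu> \<theta>)\<close>
  (\<open>entropy_production_identity\<close>). Subtracting it from the energy balance, and adding
  \<open>p\<^sup>0 (v\<^sub>t - u\<^sub>x) = 0\<close>, is the claim.\<close>

section \<open>The differential of the entropy\<close>

lemma smooth_on_imp_differentiable_at:
  assumes "smooth_on f A" "z \<in> A"
  shows "f differentiable (at z)"
proof -
  have "times_differentiable_on (Suc 0) f A"
    using assms(1) unfolding smooth_on_def by blast
  then show ?thesis using assms(2) by simp
qed

locale constitutive_laws =
  fixes \<tau>1 \<tau>2 \<kappa> \<mu> :: real
    and p e s sbar :: state_function
    and D :: "(real \<times> real \<times> real \<times> real) set"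
  assumes coefficients: "\<kappa> \<noteq> 0" "\<mu> \<noteq> 0"
    and domain: "state_domain D"
    and p_differentiable: "(v, \<theta>, q, S) \<in> D \<Longrightarrow>
      (\<lambda>(v, \<theta>, q, S). p v \<theta> q S) differentiable (at (v, \<theta>, q, S))"
    and e_differentiable: "(v, \<theta>, q, S) \<in> D \<Longrightarrow>
      (\<lambda>(v, \<theta>, q, S). e v \<theta> q S) differentiable (at (v, \<theta>, q, S))"
    and entropy: "entropy_in_energy_variables D e s sbar"
    and gibbs: "gibbs_equation D p e sbar"
    and dissipative: "dissipativity \<tau>1 \<tau>2 \<kappa> \<mu> D e sbar"
begin

lemma D_open: "open D"
  using domain unfolding state_domain_def by blast

lemma D_positive:
  assumes "(v, \<theta>, q, S) \<in> D"
  shows "v > 0" "\<theta> > 0"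
  using domain assms unfolding state_domain_def full_state_space_def by auto

lemma D_segment:
  assumes "(v, \<theta>, q, S) \<in> D" "r \<in> {0..1}"
  shows "(v, \<theta>, r * q, r * S) \<in> D"
  using domain assms unfolding state_domain_def by fast

text \<open>The Gibbs equation only concerns the \<open>(v, e)\<close> slices of \<open>sbar\<close> and dissipativity only its
  \<open>q\<close> and \<open>S\<close> lines. Since \<open>sbar\<close> is totally differentiable, uniqueness of derivatives
  identifies the restrictions of its differential to these subspaces, which span.\<close>

lemma sbar_has_derivative:
  assumes D: "(v, \<theta>, q, S) \<in> D"
  shows "((\<lambda>(v', e', q', S'). sbar v' e' q' S') has_derivative
      (\<lambda>(dv, de, dq, dS). (de + p v \<theta> q S * dv) / \<theta>
         - \<tau>1 * v * q / (\<kappa> * \<theta>\<^sup>2) * dq - \<tau>2 * v * S / (\<mu> * \<theta>) * dS))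
    (at (v, e v \<theta> q S, q, S))"
    (is "(?f has_derivative _) (at ?z)")
proof -
  let ?e = "e v \<theta> q S"
  have "?f differentiable (at ?z)"
    using entropy D unfolding entropy_in_energy_variables_def by fast
  then obtain L where L: "(?f has_derivative L) (at ?z)"
    unfolding differentiable_def by blast
  have lin: "linear L"
    using L has_derivative_linear by blast
  have "((\<lambda>(v', e'). (v', e', q, S)) has_derivative (\<lambda>(dv, de). (dv, de, 0, 0))) (at (v, ?e))"
    unfolding case_prod_beta
    by (auto intro!: derivative_eq_intros simp: fun_eq_iff zero_prod_def)
  from has_derivative_compose[OF this, of ?f L] L
  have "((\<lambda>(v', e'). sbar v' e' q S) has_derivative (\<lambda>(dv, de). L (dv, de, 0, 0))) (at (v, ?e))"
    by (simp add: case_prod_unfold)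
  moreover have "((\<lambda>(v', e'). sbar v' e' q S) has_derivative
      (\<lambda>(dv, de). (de + p v \<theta> q S * dv) / \<theta>)) (at (v, ?e))"
    using gibbs D unfolding gibbs_equation_def by fast
  ultimately have "(\<lambda>(dv, de). L (dv, de, 0, 0)) = (\<lambda>(dv, de). (de + p v \<theta> q S * dv) / \<theta>)"
    by (rule has_derivative_unique)
  then have L_ve: "L (dv, de, 0, 0) = (de + p v \<theta> q S * dv) / \<theta>" for dv de
    by (metis case_prod_conv)
  have "((\<lambda>q'. (v, ?e, q', S)) has_derivative (\<lambda>dq. (0, 0, dq, 0))) (at q)"
    by (auto intro!: derivative_eq_intros)
  from has_derivative_compose[OF this, of ?f L] L
  have "((\<lambda>q'. sbar v ?e q' S) has_derivative (\<lambda>dq. L (0, 0, dq, 0))) (at q)"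
    by simp
  moreover have "((\<lambda>q'. sbar v ?e q' S) has_derivative
      (\<lambda>dq. - (\<tau>1 * v * q / (\<kappa> * \<theta>\<^sup>2)) * dq)) (at q)"
    using dissipative D unfolding dissipativity_def has_field_derivative_def by fast
  ultimately have "(\<lambda>dq. L (0, 0, dq, 0)) = (\<lambda>dq. - (\<tau>1 * v * q / (\<kappa> * \<theta>\<^sup>2)) * dq)"
    by (rule has_derivative_unique)
  then have L_q: "L (0, 0, dq, 0) = - (\<tau>1 * v * q / (\<kappa> * \<theta>\<^sup>2)) * dq" for dq
    by metis
  have "((\<lambda>S'. (v, ?e, q, S')) has_derivative (\<lambda>dS. (0, 0, 0, dS))) (at S)"
    by (auto intro!: derivative_eq_intros)
  from has_derivative_compose[OF this, of ?f L] L
  have "((\<lambda>S'. sbar v ?e q S') has_derivative (\<lambda>dS. L (0, 0, 0, dS))) (at S)"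
    by simp
  moreover have "((\<lambda>S'. sbar v ?e q S') has_derivative
      (\<lambda>dS. - (\<tau>2 * v * S / (\<mu> * \<theta>)) * dS)) (at S)"
    using dissipative D unfolding dissipativity_def has_field_derivative_def by fast
  ultimately have "(\<lambda>dS. L (0, 0, 0, dS)) = (\<lambda>dS. - (\<tau>2 * v * S / (\<mu> * \<theta>)) * dS)"
    by (rule has_derivative_unique)
  then have L_S: "L (0, 0, 0, dS) = - (\<tau>2 * v * S / (\<mu> * \<theta>)) * dS" for dS
    by metis
  have "L (dv, de, dq, dS) = L (dv, de, 0, 0) + L (0, 0, dq, 0) + L (0, 0, 0, dS)" for dv de dq dS
    by (simp add: linear_add[OF lin, symmetric])
  then have "L = (\<lambda>(dv, de, dq, dS). (de + p v \<theta> q S * dv) / \<theta>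
      - \<tau>1 * v * q / (\<kappa> * \<theta>\<^sup>2) * dq - \<tau>2 * v * S / (\<mu> * \<theta>) * dS)"
    by (auto simp: fun_eq_iff L_ve L_q L_S)
  then show ?thesis using L by simp
qed

lemma entropy_has_derivative:
  assumes D: "(v, \<theta>, q, S) \<in> D"
    and E: "((\<lambda>(v, \<theta>, q, S). e v \<theta> q S) has_derivative E) (at (v, \<theta>, q, S))"
  shows "((\<lambda>(v, \<theta>, q, S). s v \<theta> q S) has_derivative
      (\<lambda>(dv, d\<theta>, dq, dS). (E (dv, d\<theta>, dq, dS) + p v \<theta> q S * dv) / \<theta>
         - \<tau>1 * v * q / (\<kappa> * \<theta>\<^sup>2) * dq - \<tau>2 * v * S / (\<mu> * \<theta>) * dS))
    (at (v, \<theta>, q, S))"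
proof -
  let ?g = "\<lambda>z. (fst z, (case z of (v, \<theta>, q, S) \<Rightarrow> e v \<theta> q S), fst (snd (snd z)), snd (snd (snd z)))"
  have g: "(?g has_derivative (\<lambda>h. (fst h, E h, fst (snd (snd h)), snd (snd (snd h)))))
      (at (v, \<theta>, q, S))"
    by (intro has_derivative_Pair has_derivative_fst has_derivative_snd has_derivative_ident E)
  have "((\<lambda>(v', e', q', S'). sbar v' e' q' S') has_derivative
      (\<lambda>(dv, de, dq, dS). (de + p v \<theta> q S * dv) / \<theta>
         - \<tau>1 * v * q / (\<kappa> * \<theta>\<^sup>2) * dq - \<tau>2 * v * S / (\<mu> * \<theta>) * dS))
    (at (?g (v, \<theta>, q, S)))"
    using sbar_has_derivative[OF D] by simp
  from has_derivative_compose[OF g this]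
  have "((\<lambda>z. (case ?g z of (v', e', q', S') \<Rightarrow> sbar v' e' q' S')) has_derivative
      (\<lambda>(dv, d\<theta>, dq, dS). (E (dv, d\<theta>, dq, dS) + p v \<theta> q S * dv) / \<theta>
         - \<tau>1 * v * q / (\<kappa> * \<theta>\<^sup>2) * dq - \<tau>2 * v * S / (\<mu> * \<theta>) * dS)) (at (v, \<theta>, q, S))"
    by (simp add: case_prod_unfold)
  then show ?thesis
  proof (rule has_derivative_transform_within_open[OF _ D_open D])
    fix z assume "z \<in> D"
    then show "(case ?g z of (v', e', q', S') \<Rightarrow> sbar v' e' q' S') = (case z of (v, \<theta>, q, S) \<Rightarrow> s v \<theta> q S)"
      using entropy unfolding entropy_in_energy_variables_def by (auto split: prod.splits)
  qed
qed

section \<open>The Massieu function and the constitutive laws\<close>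

definition massieu :: state_function
  where "massieu v \<theta> q S = s v \<theta> q S - e v \<theta> q S / \<theta>"

lemma massieu_has_derivative:
  assumes D: "(v, \<theta>, q, S) \<in> D"
  shows "((\<lambda>(v, \<theta>, q, S). massieu v \<theta> q S) has_derivative
      (\<lambda>(dv, d\<theta>, dq, dS). e v \<theta> q S / \<theta>\<^sup>2 * d\<theta> + p v \<theta> q S / \<theta> * dv
         - \<tau>1 * v * q / (\<kappa> * \<theta>\<^sup>2) * dq - \<tau>2 * v * S / (\<mu> * \<theta>) * dS))
    (at (v, \<theta>, q, S))"
proof -
  obtain E where E: "((\<lambda>(v, \<theta>, q, S). e v \<theta> q S) has_derivative E) (at (v, \<theta>, q, S))"
    using e_differentiable[OF D] unfolding differentiable_def by blast
  have \<theta>: "\<theta> \<noteq> 0" using D_positive[OF D] by simp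
  have "((\<lambda>z. (case z of (v, \<theta>, q, S) \<Rightarrow> s v \<theta> q S)
           - (case z of (v, \<theta>, q, S) \<Rightarrow> e v \<theta> q S) / fst (snd z)) has_derivative
      (\<lambda>(dv, d\<theta>, dq, dS). e v \<theta> q S / \<theta>\<^sup>2 * d\<theta> + p v \<theta> q S / \<theta> * dv
         - \<tau>1 * v * q / (\<kappa> * \<theta>\<^sup>2) * dq - \<tau>2 * v * S / (\<mu> * \<theta>) * dS))
    (at (v, \<theta>, q, S))"
    by (rule has_derivative_eq_rhs[OF has_derivative_diff[OF entropy_has_derivative[OF D E]
            has_derivative_divide[OF E has_derivative_fst[OF has_derivative_snd[OF has_derivative_ident]]]]])
      (use \<theta> in \<open>auto simp: fun_eq_iff field_simps eval_nat_numeral\<close>)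
  then show ?thesis
    by (simp add: massieu_def case_prod_unfold)
qed

text \<open>Along the segment \<open>r \<mapsto> (v, \<theta>, r q, r S)\<close>, which stays in the domain, the derivative of the
  Massieu function is linear in \<open>r\<close> with a coefficient that involves neither \<open>e\<close> nor \<open>p\<close>.\<close>

lemma massieu_flux_part:
  assumes D: "(v, \<theta>, q, S) \<in> D"
  shows "massieu v \<theta> q S = massieu v \<theta> 0 0
      - \<tau>1 * v / (2 * \<kappa> * \<theta>\<^sup>2) * q\<^sup>2 - \<tau>2 * v / (2 * \<mu> * \<theta>) * S\<^sup>2"
proof -
  define c where "c = \<tau>1 * v / (2 * \<kappa> * \<theta>\<^sup>2) * q\<^sup>2 + \<tau>2 * v / (2 * \<mu> * \<theta>) * S\<^sup>2"
  let ?f = "\<lambda>r. massieu v \<theta> (r * q) (r * S) + c * r\<^sup>2"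
  have "(?f has_real_derivative 0) (at r)" if "r \<in> {0..1}" for r
  proof -
    have g: "((\<lambda>r. (v, \<theta>, r * q, r * S)) has_derivative (\<lambda>h. (0, 0, h * q, h * S))) (at r)"
      by (auto intro!: derivative_eq_intros)
    have "((\<lambda>r. massieu v \<theta> (r * q) (r * S)) has_derivative (\<lambda>h. - (2 * c * r) * h)) (at r)"
      using has_derivative_compose[OF g massieu_has_derivative[OF D_segment[OF D that]]]
      by (simp add: c_def field_simps power2_eq_square)
    then have "((\<lambda>r. massieu v \<theta> (r * q) (r * S)) has_real_derivative - (2 * c * r)) (at r)"
      unfolding has_field_derivative_def .
    then show ?thesis by (auto intro!: derivative_eq_intros)
  qed
  then have "\<exists>k. \<forall>r\<in>{0..1}. ?f r = k"
    by (intro has_field_derivative_zero_constant ballI) (simp_all add: has_field_derivative_at_within)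
  then obtain k where k: "?f r = k" if "r \<in> {0..1}" for r
    by blast
  have "?f 1 = ?f 0"
    using k[of 1] k[of 0] by simp
  then show ?thesis by (simp add: c_def)
qed

lemma massieu_deriv_temperature:
  assumes D: "(v, \<theta>, q, S) \<in> D"
  shows "((\<lambda>\<theta>. massieu v \<theta> q S) has_real_derivative e v \<theta> q S / \<theta>\<^sup>2) (at \<theta>)"
proof -
  have g: "((\<lambda>\<theta>. (v, \<theta>, q, S)) has_derivative (\<lambda>h. (0, h, 0, 0))) (at \<theta>)"
    by (auto intro!: derivative_eq_intros simp: zero_prod_def)
  have "((\<lambda>\<theta>. massieu v \<theta> q S) has_derivative (\<lambda>h. e v \<theta> q S * h / \<theta>\<^sup>2)) (at \<theta>)"
    using has_derivative_compose[OF g massieu_has_derivative[OF D]] by simp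
  then show ?thesis
    by (rule has_derivative_imp_has_field_derivative) simp
qed

lemma massieu_deriv_volume:
  assumes D: "(v, \<theta>, q, S) \<in> D"
  shows "((\<lambda>v. massieu v \<theta> q S) has_real_derivative p v \<theta> q S / \<theta>) (at v)"
proof -
  have g: "((\<lambda>v. (v, \<theta>, q, S)) has_derivative (\<lambda>h. (h, 0, 0, 0))) (at v)"
    by (auto intro!: derivative_eq_intros simp: zero_prod_def)
  have "((\<lambda>v. massieu v \<theta> q S) has_derivative (\<lambda>h. p v \<theta> q S * h / \<theta>)) (at v)"
    using has_derivative_compose[OF g massieu_has_derivative[OF D]] by simp
  then show ?thesis
    by (rule has_derivative_imp_has_field_derivative) simp
qed

text \<open>The formula of \<open>massieu_flux_part\<close> holds in a neighbourhood of \<open>\<theta>\<close>, so it may be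
  differentiated there. The derivative of the Massieu function in \<open>\<theta>\<close> is \<open>e / \<theta>\<^sup>2\<close>, both at
  \<open>(v, \<theta>, q, S)\<close> and at \<open>(v, \<theta>, 0, 0)\<close>; this is why the \<open>q\<^sup>2\<close> coefficient, of order two in
  \<open>1 / \<theta>\<close> in the Massieu function, doubles in the energy.\<close>

lemma energy_law:
  assumes D: "(v, \<theta>, q, S) \<in> D"
  shows "e v \<theta> q S = ns_part e v \<theta> + \<tau>1 * v / (\<kappa> * \<theta>) * q\<^sup>2 + \<tau>2 * v / (2 * \<mu>) * S\<^sup>2"
proof -
  have \<theta>: "\<theta> \<noteq> 0" using D_positive[OF D] by simp
  have D0: "(v, \<theta>, 0, 0) \<in> D" using D_segment[OF D, of 0] by simp
  let ?N = "(\<lambda>\<theta>'. (v, \<theta>', q, S)) -` D"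
  have N: "open ?N" "\<theta> \<in> ?N"
    using D by (auto intro!: open_vimage D_open continuous_intros)
  have "((\<lambda>\<theta>. massieu v \<theta> 0 0
      - \<tau>1 * v / (2 * \<kappa> * \<theta>\<^sup>2) * q\<^sup>2 - \<tau>2 * v / (2 * \<mu> * \<theta>) * S\<^sup>2)
      has_real_derivative e v \<theta> 0 0 / \<theta>\<^sup>2
        + \<tau>1 * v / \<kappa> * q\<^sup>2 / \<theta> ^ 3 + \<tau>2 * v / (2 * \<mu>) * S\<^sup>2 / \<theta>\<^sup>2) (at \<theta>)"
    using \<theta> coefficients by (auto intro!: derivative_eq_intros massieu_deriv_temperature[OF D0])
      (simp add: field_simps eval_nat_numeral)
  then have "((\<lambda>\<theta>. massieu v \<theta> q S) has_real_derivative e v \<theta> 0 0 / \<theta>\<^sup>2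
        + \<tau>1 * v / \<kappa> * q\<^sup>2 / \<theta> ^ 3 + \<tau>2 * v / (2 * \<mu>) * S\<^sup>2 / \<theta>\<^sup>2) (at \<theta>)"
    by (rule has_field_derivative_transform_within_open[OF _ N])
      (simp add: massieu_flux_part[of v _ q S])
  from DERIV_unique[OF massieu_deriv_temperature[OF D] this] \<theta>
  have "e v \<theta> q S = (e v \<theta> 0 0 / \<theta>\<^sup>2
      + \<tau>1 * v / \<kappa> * q\<^sup>2 / \<theta> ^ 3 + \<tau>2 * v / (2 * \<mu>) * S\<^sup>2 / \<theta>\<^sup>2) * \<theta>\<^sup>2"
    by (subst (asm) nonzero_divide_eq_eq) simp_all
  also have "\<dots> = e v \<theta> 0 0 + \<tau>1 * v / (\<kappa> * \<theta>) * q\<^sup>2 + \<tau>2 * v / (2 * \<mu>) * S\<^sup>2"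
    using \<theta> coefficients by (simp add: field_simps eval_nat_numeral)
  finally show ?thesis by (simp add: ns_part_def)
qed

text \<open>The same argument in the variable \<open>v\<close>, where the derivative is \<open>p / \<theta>\<close>.\<close>

lemma pressure_law:
  assumes D: "(v, \<theta>, q, S) \<in> D"
  shows "p v \<theta> q S = ns_part p v \<theta> - \<tau>1 / (2 * \<kappa> * \<theta>) * q\<^sup>2 - \<tau>2 / (2 * \<mu>) * S\<^sup>2"
proof -
  have \<theta>: "\<theta> \<noteq> 0" using D_positive[OF D] by simp
  have D0: "(v, \<theta>, 0, 0) \<in> D" using D_segment[OF D, of 0] by simp
  let ?N = "(\<lambda>v'. (v', \<theta>, q, S)) -` D"
  have N: "open ?N" "v \<in> ?N"
    using D by (auto intro!: open_vimage D_open continuous_intros)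
  have "((\<lambda>v. massieu v \<theta> 0 0
      - \<tau>1 * v / (2 * \<kappa> * \<theta>\<^sup>2) * q\<^sup>2 - \<tau>2 * v / (2 * \<mu> * \<theta>) * S\<^sup>2)
      has_real_derivative p v \<theta> 0 0 / \<theta>
        - \<tau>1 / (2 * \<kappa> * \<theta>\<^sup>2) * q\<^sup>2 - \<tau>2 / (2 * \<mu> * \<theta>) * S\<^sup>2) (at v)"
    using \<theta> coefficients by (auto intro!: derivative_eq_intros massieu_deriv_volume[OF D0])
  then have "((\<lambda>v. massieu v \<theta> q S) has_real_derivative p v \<theta> 0 0 / \<theta>
        - \<tau>1 / (2 * \<kappa> * \<theta>\<^sup>2) * q\<^sup>2 - \<tau>2 / (2 * \<mu> * \<theta>) * S\<^sup>2) (at v)"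
    by (rule has_field_derivative_transform_within_open[OF _ N])
      (simp add: massieu_flux_part[of _ \<theta> q S])
  from DERIV_unique[OF massieu_deriv_volume[OF D] this] \<theta>
  have "p v \<theta> q S = (p v \<theta> 0 0 / \<theta>
      - \<tau>1 / (2 * \<kappa> * \<theta>\<^sup>2) * q\<^sup>2 - \<tau>2 / (2 * \<mu> * \<theta>) * S\<^sup>2) * \<theta>"
    by (subst (asm) nonzero_divide_eq_eq) simp_all
  also have "\<dots> = p v \<theta> 0 0 - \<tau>1 / (2 * \<kappa> * \<theta>) * q\<^sup>2 - \<tau>2 / (2 * \<mu>) * S\<^sup>2"
    using \<theta> coefficients by (simp add: field_simps eval_nat_numeral)
  finally show ?thesis by (simp add: ns_part_def)
qed

lemma entropy_law:
  assumes D: "(v, \<theta>, q, S) \<in> D"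
  shows "s v \<theta> q S = ns_part s v \<theta> + \<tau>1 * v / (2 * \<kappa> * \<theta>\<^sup>2) * q\<^sup>2"
proof -
  have "\<theta> \<noteq> 0" using D_positive[OF D] by simp
  have "s v \<theta> q S = massieu v \<theta> q S + e v \<theta> q S / \<theta>"
    by (simp add: massieu_def)
  also have "\<dots> = s v \<theta> 0 0 + \<tau>1 * v / (2 * \<kappa> * \<theta>\<^sup>2) * q\<^sup>2"
    unfolding massieu_flux_part[OF D] energy_law[OF D] ns_part_def unfolding massieu_def
    using \<open>\<theta> \<noteq> 0\<close> coefficients by (simp add: field_simps eval_nat_numeral)
  finally show ?thesis by (simp add: ns_part_def)
qed

lemma relative_entropy_law:
  assumes D: "(v, \<theta>, q, S) \<in> D"
  shows "relative_entropy p e s v u \<theta> q S = ns_relative_entropy p e s v u \<theta>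
      + (1 - 1 / (2 * \<theta>)) * (\<tau>1 * v / (\<kappa> * \<theta>)) * q\<^sup>2 + \<tau>2 * v / (2 * \<mu>) * S\<^sup>2"
proof -
  have "\<theta> \<noteq> 0" using D_positive[OF D] by simp
  then show ?thesis
    using coefficients
    unfolding relative_entropy_def ns_relative_entropy_def energy_law[OF D] entropy_law[OF D]
    by (simp add: field_simps eval_nat_numeral)
qed

section \<open>The entropy balance along solutions\<close>

lemma has_real_derivative_along_curve:
  assumes f: "((\<lambda>(v, \<theta>, q, S). f v \<theta> q S) has_derivative F) (at (v r, \<theta> r, q r, S r))"
    and "(v has_real_derivative v') (at r)" "(\<theta> has_real_derivative \<theta>') (at r)"
    and "(q has_real_derivative q') (at r)" "(S has_real_derivative S') (at r)"
  shows "((\<lambda>r. f (v r) (\<theta> r) (q r) (S r)) has_real_derivative F (v', \<theta>', q', S')) (at r)"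
proof -
  interpret F: linear F using f by (rule has_derivative_linear)
  have "((\<lambda>r. (v r, \<theta> r, q r, S r)) has_derivative (\<lambda>h. h *\<^sub>R (v', \<theta>', q', S'))) (at r)"
    using assms(2-) unfolding has_field_derivative_def
    by (auto intro!: derivative_eq_intros simp: mult_ac)
  from has_derivative_compose[OF this f]
  have "((\<lambda>r. f (v r) (\<theta> r) (q r) (S r)) has_derivative (\<lambda>h. h * F (v', \<theta>', q', S'))) (at r)"
    by (simp only: F.scaleR prod.case real_scaleR_def)
  then show ?thesis
    by (rule has_derivative_imp_has_field_derivative) simp
qed

lemma dt_eqI: "((\<lambda>t. f t x) has_real_derivative d) (at t) \<Longrightarrow> dt f t x = d"
  unfolding dt_def by (rule DERIV_imp_deriv)

lemma dx_eqI: "((\<lambda>x. f t x) has_real_derivative d) (at x) \<Longrightarrow> dx f t x = d"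
  unfolding dx_def by (rule DERIV_imp_deriv)

lemma differentiable_on_open_partials:
  fixes f :: field
  assumes "(\<lambda>(t, x). f t x) differentiable_on W" "open W" "(t, x) \<in> W"
  shows "((\<lambda>t. f t x) has_real_derivative dt f t x) (at t)"
    and "((\<lambda>x. f t x) has_real_derivative dx f t x) (at x)"
proof -
  have "(\<lambda>(t, x). f t x) differentiable (at (t, x))"
    using assms by (meson differentiable_on_eq_differentiable_at)
  then obtain F where F: "((\<lambda>(t, x). f t x) has_derivative F) (at (t, x))"
    unfolding differentiable_def by blast
  have gt: "((\<lambda>t. (t, x)) has_derivative (\<lambda>h. (h, 0))) (at t)"
    by (intro has_derivative_Pair has_derivative_ident has_derivative_const)
  have gx: "((\<lambda>x. (t, x)) has_derivative (\<lambda>h. (0, h))) (at x)"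
    by (intro has_derivative_Pair has_derivative_ident has_derivative_const)
  have "(\<lambda>t. f t x) differentiable (at t)" "(\<lambda>x. f t x) differentiable (at x)"
    using has_derivative_compose[OF gt F] has_derivative_compose[OF gx F]
    by (simp_all add: differentiableI)
  then show "((\<lambda>t. f t x) has_real_derivative dt f t x) (at t)"
    and "((\<lambda>x. f t x) has_real_derivative dx f t x) (at x)"
    unfolding dt_def dx_def
    by (simp_all add: DERIV_deriv_iff_real_differentiable)
qed

text \<open>The production of entropy, pointwise, with the values of the partial derivatives as plain
  numbers: \<open>q\<^sub>t\<close> and \<open>S\<^sub>t\<close> enter the entropy differential only through \<open>\<tau>1 q\<^sub>t\<close> and
  \<open>\<tau>2 S\<^sub>t\<close>, which the relaxation equations express. The equation for \<open>q\<close> supplies the part \<open>q \<theta>\<^sub>x / \<theta>\<^sup>2\<close> of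
  \<open>- (q / \<theta>)\<^sub>x\<close>, and the equation for \<open>S\<close> cancels the viscous work \<open>S u\<^sub>x / \<theta>\<close>.\<close>

lemma entropy_production_identity:
  fixes v \<theta> q S ux qx \<theta>x :: real
  assumes "v \<noteq> 0" "\<theta> \<noteq> 0" "\<kappa> \<noteq> 0" "\<mu> \<noteq> 0"
    and "\<tau>1 * qt + q + \<kappa> * \<theta>x / v = 0"
    and "\<tau>2 * St + S = \<mu> * ux / v"
    and "et = - P * ux - qx + S * ux"
  shows "(et + P * ux) / \<theta> - \<tau>1 * v * q / (\<kappa> * \<theta>\<^sup>2) * qt - \<tau>2 * v * S / (\<mu> * \<theta>) * St
    = - (qx / \<theta> - q * \<theta>x / \<theta>\<^sup>2) + v * q\<^sup>2 / (\<kappa> * \<theta>\<^sup>2) + v * S\<^sup>2 / (\<mu> * \<theta>)"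
proof -
  have "\<tau>1 * v * q / (\<kappa> * \<theta>\<^sup>2) * qt = v * q / (\<kappa> * \<theta>\<^sup>2) * (\<tau>1 * qt)"
    by simp
  also have "\<tau>1 * qt = - q - \<kappa> * \<theta>x / v"
    using assms(5) by simp
  also have "v * q / (\<kappa> * \<theta>\<^sup>2) * \<dots> = - v * q\<^sup>2 / (\<kappa> * \<theta>\<^sup>2) - q * \<theta>x / \<theta>\<^sup>2"
    using assms(1-4) by (simp add: field_simps power2_eq_square)
  finally have 1: "\<tau>1 * v * q / (\<kappa> * \<theta>\<^sup>2) * qt = - v * q\<^sup>2 / (\<kappa> * \<theta>\<^sup>2) - q * \<theta>x / \<theta>\<^sup>2" .
  have "\<tau>2 * v * S / (\<mu> * \<theta>) * St = v * S / (\<mu> * \<theta>) * (\<tau>2 * St)"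
    by simp
  also have "\<tau>2 * St = \<mu> * ux / v - S"
    using assms(6) by simp
  also have "v * S / (\<mu> * \<theta>) * \<dots> = S * ux / \<theta> - v * S\<^sup>2 / (\<mu> * \<theta>)"
    using assms(1-4) by (simp add: field_simps power2_eq_square)
  finally have 2: "\<tau>2 * v * S / (\<mu> * \<theta>) * St = S * ux / \<theta> - v * S\<^sup>2 / (\<mu> * \<theta>)" .
  show ?thesis
    unfolding 1 2 assms(7) by (simp add: diff_divide_distrib add_divide_distrib)
qed

lemma relative_entropy_balance:
  assumes sol: "hyperbolic_ns_solution \<tau>1 \<tau>2 \<kappa> \<mu> D p e W v u \<theta> q S"
    and W: "(t, x) \<in> W"
  shows "dt (\<lambda>t x. relative_entropy p e s (v t x) (u t x) (\<theta> t x) (q t x) (S t x)) t x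
      + dx (\<lambda>t x. u t x * (along p v \<theta> q S t x - ns_part p 1 1)
                 + (1 - 1 / \<theta> t x) * q t x - u t x * S t x) t x
      + v t x * (q t x)\<^sup>2 / (\<kappa> * (\<theta> t x)\<^sup>2) + v t x * (S t x)\<^sup>2 / (\<mu> * \<theta> t x) = 0"
proof -
  note solution = sol[unfolded hyperbolic_ns_solution_def]
  have fields: "(\<lambda>(t, x). f t x) differentiable_on W" if "f \<in> {v, u, \<theta>, q, S}" for f
    using solution that by blast
  have "open W" using solution by blast
  note partials = differentiable_on_open_partials[OF fields \<open>open W\<close> W]
  have dts: "((\<lambda>t. v t x) has_real_derivative dt v t x) (at t)"
    "((\<lambda>t. u t x) has_real_derivative dt u t x) (at t)"
    "((\<lambda>t. \<theta> t x) has_real_derivative dt \<theta> t x) (at t)"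
    "((\<lambda>t. q t x) has_real_derivative dt q t x) (at t)"
    "((\<lambda>t. S t x) has_real_derivative dt S t x) (at t)"
    by (rule partials(1), simp)+
  have dxs: "((\<lambda>x. v t x) has_real_derivative dx v t x) (at x)"
    "((\<lambda>x. u t x) has_real_derivative dx u t x) (at x)"
    "((\<lambda>x. \<theta> t x) has_real_derivative dx \<theta> t x) (at x)"
    "((\<lambda>x. q t x) has_real_derivative dx q t x) (at x)"
    "((\<lambda>x. S t x) has_real_derivative dx S t x) (at x)"
    by (rule partials(2), simp)+
  have eqs: "(v t x, \<theta> t x, q t x, S t x) \<in> D"
    "dt v t x - dx u t x = 0"
    "dt u t x + dx (along p v \<theta> q S) t x = dx S t x"
    "dt (\<lambda>t x. along e v \<theta> q S t x + (u t x)\<^sup>2 / 2) t x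
         + dx (\<lambda>t x. u t x * along p v \<theta> q S t x) t x + dx q t x
         = dx (\<lambda>t x. u t x * S t x) t x"
    "\<tau>1 * dt q t x + q t x + \<kappa> * dx \<theta> t x / v t x = 0"
    "\<tau>2 * dt S t x + S t x = \<mu> * dx u t x / v t x"
    using bspec[OF solution[THEN conjunct2, THEN conjunct2] W] unfolding prod.case by blast+
  note D = eqs(1)
  have pos: "v t x \<noteq> 0" "\<theta> t x \<noteq> 0" using D_positive[OF D] by simp_all
  let ?P = "along p v \<theta> q S t x"
  obtain E where E: "((\<lambda>(v, \<theta>, q, S). e v \<theta> q S) has_derivative E)
      (at (v t x, \<theta> t x, q t x, S t x))"
    using e_differentiable[OF D] unfolding differentiable_def by blast
  obtain P where P: "((\<lambda>(v, \<theta>, q, S). p v \<theta> q S) has_derivative P)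
      (at (v t x, \<theta> t x, q t x, S t x))"
    using p_differentiable[OF D] unfolding differentiable_def by blast
  define et where "et = E (dt v t x, dt \<theta> t x, dt q t x, dt S t x)"
  define st where "st = (et + ?P * dx u t x) / \<theta> t x
      - \<tau>1 * v t x * q t x / (\<kappa> * (\<theta> t x)\<^sup>2) * dt q t x - \<tau>2 * v t x * S t x / (\<mu> * \<theta> t x) * dt S t x"
  have e_t: "((\<lambda>t. along e v \<theta> q S t x) has_real_derivative et) (at t)"
    unfolding along_def et_def by (rule has_real_derivative_along_curve[OF E dts(1,3-5)])
  have "((\<lambda>t. along s v \<theta> q S t x) has_real_derivative
     (case (dt v t x, dt \<theta> t x, dt q t x, dt S t x) of (dv, d\<theta>, dq, dS) \<Rightarrow>
       (E (dv, d\<theta>, dq, dS) + p (v t x) (\<theta> t x) (q t x) (S t x) * dv) / \<theta> t x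
         - \<tau>1 * v t x * q t x / (\<kappa> * (\<theta> t x)\<^sup>2) * dq - \<tau>2 * v t x * S t x / (\<mu> * \<theta> t x) * dS)) (at t)"
    unfolding along_def
    by (rule has_real_derivative_along_curve[OF entropy_has_derivative[OF D E] dts(1,3-5)])
  then have s_t: "((\<lambda>t. along s v \<theta> q S t x) has_real_derivative st) (at t)"
    using eqs(2) by (simp add: st_def et_def along_def)
  \<comment> \<open>\<open>p\<^sub>x\<close> cancels between \<open>(u p)\<^sub>x\<close> and the momentum equation, but the product rule for
    \<open>(u p)\<^sub>x\<close> presupposes that it exists.\<close>
  have "((\<lambda>x. along p v \<theta> q S t x) has_real_derivative
      P (dx v t x, dx \<theta> t x, dx q t x, dx S t x)) (at x)"
    unfolding along_def by (rule has_real_derivative_along_curve[OF P dxs(1,3-5)])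
  then have p_x: "((\<lambda>x. along p v \<theta> q S t x) has_real_derivative dx (along p v \<theta> q S) t x) (at x)"
    using dx_eqI by metis
  have energy_t: "dt (\<lambda>t x. along e v \<theta> q S t x + (u t x)\<^sup>2 / 2) t x = et + u t x * dt u t x"
    by (rule dt_eqI) (auto intro!: derivative_eq_intros e_t dts)
  have up_x: "dx (\<lambda>t x. u t x * along p v \<theta> q S t x) t x
      = dx u t x * ?P + u t x * dx (along p v \<theta> q S) t x"
    by (rule dx_eqI) (auto intro!: derivative_eq_intros p_x dxs)
  have uS_x: "dx (\<lambda>t x. u t x * S t x) t x = dx u t x * S t x + u t x * dx S t x"
    by (rule dx_eqI) (auto intro!: derivative_eq_intros dxs)
  have "dt u t x = dx S t x - dx (along p v \<theta> q S) t x"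
    using eqs(3) by simp
  then have kinetic: "u t x * dt u t x = u t x * dx S t x - u t x * dx (along p v \<theta> q S) t x"
    by (simp add: right_diff_distrib)
  then have et: "et = - ?P * dx u t x - dx q t x + S t x * dx u t x"
    using eqs(4) unfolding energy_t up_x uS_x by (simp add: algebra_simps)
  have st: "st = - (dx q t x / \<theta> t x - q t x * dx \<theta> t x / (\<theta> t x)\<^sup>2)
      + v t x * (q t x)\<^sup>2 / (\<kappa> * (\<theta> t x)\<^sup>2) + v t x * (S t x)\<^sup>2 / (\<mu> * \<theta> t x)"
    unfolding st_def using pos coefficients eqs(5,6) et by (rule entropy_production_identity)
  have \<eta>_t: "dt (\<lambda>t x. relative_entropy p e s (v t x) (u t x) (\<theta> t x) (q t x) (S t x)) t x
      = et + u t x * dt u t x + p 1 1 0 0 * dt v t x - st"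
    unfolding relative_entropy_def
    by (rule dt_eqI)
      (auto intro!: derivative_eq_intros e_t[unfolded along_def] s_t[unfolded along_def] dts)
  have flux_x: "dx (\<lambda>t x. u t x * (along p v \<theta> q S t x - ns_part p 1 1)
                 + (1 - 1 / \<theta> t x) * q t x - u t x * S t x) t x
      = dx u t x * (?P - p 1 1 0 0) + u t x * dx (along p v \<theta> q S) t x
        + dx q t x - (dx q t x / \<theta> t x - q t x * dx \<theta> t x / (\<theta> t x)\<^sup>2)
        - (dx u t x * S t x + u t x * dx S t x)"
    unfolding ns_part_def
    by (rule dx_eqI)
      (use pos in \<open>auto intro!: derivative_eq_intros p_x dxs
        simp: field_simps power2_eq_square\<close>)
  show ?thesis
    using eqs(2) kinetic
    unfolding \<eta>_t flux_x st et by (simp add: algebra_simps)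
qed

end

theorem propositionB1:
  fixes \<tau>1 \<tau>2 \<kappa> \<mu> :: real
    and p e s sbar :: state_function
    and D :: "(real \<times> real \<times> real \<times> real) set"
  assumes "\<tau>1 > 0" "\<tau>2 > 0" "\<kappa> > 0" "\<mu> > 0"
    and "state_domain D"
    and "smooth_on (\<lambda>(v, \<theta>, q, S). p v \<theta> q S) D"
    and "smooth_on (\<lambda>(v, \<theta>, q, S). e v \<theta> q S) D"
    and "smooth_on (\<lambda>(v, \<theta>, q, S). s v \<theta> q S) D"
    and "entropy_in_energy_variables D e s sbar"
    and "gibbs_equation D p e sbar"
    and "dissipativity \<tau>1 \<tau>2 \<kappa> \<mu> D e sbar"
    and "quadratic_in_flux D e"
    and "quadratic_in_flux D p"
  shows
    "(\<forall>(v, \<theta>, q, S)\<in>D.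
        p v \<theta> q S = ns_part p v \<theta> - \<tau>1 / (2 * \<kappa> * \<theta>) * q\<^sup>2 - \<tau>2 / (2 * \<mu>) * S\<^sup>2 \<and>
        e v \<theta> q S = ns_part e v \<theta> + \<tau>1 * v / (\<kappa> * \<theta>) * q\<^sup>2 + \<tau>2 * v / (2 * \<mu>) * S\<^sup>2 \<and>
        s v \<theta> q S = ns_part s v \<theta> + \<tau>1 * v / (2 * \<kappa> * \<theta>\<^sup>2) * q\<^sup>2) \<and>
     (\<forall>(v, \<theta>, q, S)\<in>D. \<forall>u.
        relative_entropy p e s v u \<theta> q S =
          ns_relative_entropy p e s v u \<theta>
            + (1 - 1 / (2 * \<theta>)) * (\<tau>1 * v / (\<kappa> * \<theta>)) * q\<^sup>2 + \<tau>2 * v / (2 * \<mu>) * S\<^sup>2) \<and>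
     (\<forall>W v u \<theta> q S. hyperbolic_ns_solution \<tau>1 \<tau>2 \<kappa> \<mu> D p e W v u \<theta> q S \<longrightarrow>
        (\<forall>(t, x)\<in>W.
           dt (\<lambda>t x. relative_entropy p e s (v t x) (u t x) (\<theta> t x) (q t x) (S t x)) t x
           + dx (\<lambda>t x. u t x * (along p v \<theta> q S t x - ns_part p 1 1)
                      + (1 - 1 / \<theta> t x) * q t x - u t x * S t x) t x
           + v t x * (q t x)\<^sup>2 / (\<kappa> * (\<theta> t x)\<^sup>2) + v t x * (S t x)\<^sup>2 / (\<mu> * \<theta> t x) = 0))"
proof -
  interpret constitutive_laws \<tau>1 \<tau>2 \<kappa> \<mu> p e s sbar D
    using assms smooth_on_imp_differentiable_at[OF assms(6)] smooth_on_imp_differentiable_at[OF assms(7)]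
    by unfold_locales simp_all
  show ?thesis
    apply (intro conjI)
      apply (clarify, intro conjI; rule pressure_law energy_law entropy_law; assumption)
     apply (clarify, rule relative_entropy_law, assumption)
    apply (clarify, rule relative_entropy_balance, assumption+)
    done
qed

end
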